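(* Let $\mathcal{M}$ be a weak model category, $\lambda$ a regular cardinal, $c\in\mathcal{M}$ a cofibrant object and $\phi\in\mathbb{L}^{\mathcal{M}}_\lambda(c)$ a formula in context $c$. (1) ($1^{st}$ invariance theorem) Let $v_1,v_2:c\to X$ be two homotopic maps with $X$ fibrant. Then $X\vdash\phi(v_1)$ if and only if $X\vdash\phi(v_2)$. (2) ($2^{nd}$ invariance theorem) Let $f:X\to Y$ be a weak equivalence between two fibrant objects and $v:c\to X$ any map. Then $X\vdash\phi(v)$ if and only if $Y\vdash\phi(f\circ v)$.
   Context: **Weak model categories.** A weak model category is a category $\mathcal{M}$ with three classes of maps, cofibrations, fibrations and weak equivalences, such that (an object $X$ is cofibrant if $0\to X$ is a cofibration, fibrant if $X\to1$ is a fibration; a trivial (co)fibration is a (co)fibration that is a weak equivalence): (i) there are an initial object $0$ and a terminal object $1$, $\mathrm{id}_0$ is a cofibration and $\mathrm{id}_1$ a fibration; (ii) composites of cofibrations with cofibrant domain are cofibrations, composites of fibrations with fibrant codomain are fibrations; (iii) weak equivalences satisfy 2-out-of-3 for composable pairs between objects each of which is fibrant or cofibrant; (iv) isomorphisms between objects that are fibrant or cofibrant are weak equivalences; (v) the pushout of a cofibration $A\to C$ along a map $A\to B$ with $A,B$ cofibrant exists and $B\to B\sqcup_A C$ is a cofibration; (vi) dually for pullbacks of fibrations along maps between fibrant objects; (vii) the three classes are closed under isomorphism of arrows; (viii) every map from a cofibrant to a fibrant object factors as a cofibration followed by a trivial fibration, and also as a trivial cofibration followed by a fibration; (ix) a cofibration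 between cofibrant objects has the left lifting property against a fibration between fibrant objects as soon as one of the two is a weak equivalence. **Homotopy.** For $c$ cofibrant, a weak cylinder object is an object $Ic$ with a cofibration $c\sqcup c\to Ic$, a trivial cofibration $c\to Dc$ and a weak equivalence $Ic\to Dc$ such that $c\sqcup c\to Ic\to Dc$ equals $c\sqcup c\xrightarrow{\nabla}c\to Dc$. For $X$ fibrant, $v_1,v_2:c\to X$ are homotopic if $(v_1,v_2):c\sqcup c\to X$ extends along $c\sqcup c\to Ic$ for a weak cylinder object; equivalently $v_1,v_2$ become equal in the localization at weak equivalences of the full subcategory of objects that are fibrant or cofibrant. **The language.** Let $\mathcal{M}^{cof}$ be the full subcategory of cofibrant objects. A $\lambda$-boolean algebra is a boolean algebra with joins of $\lambda$-small families; $\mathbf{Bool}_\lambda$ is the category of these, with boolean algebra morphisms preserving $\lambda$-small joins. A $\lambda$-boolean algebra over $\mathcal{M}^{cof}$ is a functor $\mathcal{B}:\mathcal{M}^{cof}\to\mathbf{Bool}_\lambda$ (write $f^*:\mathcal{B}(A)\to\mathcal{B}(B)$ for the action of $f:A\to B$) such that for every cofibration $i:A\to B$ between cofibrant objects $i^*$ has a left adjoint $\exists_i:\mathcal{B}(B)\to\mathcal{B}(A)$, and for every pushout of $i$ along $f:A\to A'$, with resulting maps $i':A'\to B'$ and $f':B\to B'$, one has $f^*\exists_i=\exists_{i'}f'^*$. Morphisms are natural transformations commuting with all $\exists_i$. $\mathbb{L}^{\mathcal{M}}_\lambda$ denotes the initial $\lambda$-boolean algebra over $\mathcal{M}^{cof}$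 (formed in a larger universe if $\mathcal{M}^{cof}$ is large). Elements of $\mathbb{L}^{\mathcal{M}}_\lambda(c)$ are called formulas in context $c$. **Validity.** For $X\in\mathcal{M}$, the assignment $c\mapsto\mathcal{P}(\mathrm{Hom}(c,X))$ (power set), with $g^*(S)=\{v:d\to X\mid vg\in S\}$ for $g:c\to d$ and $\exists_i(S)=\{vi\mid v\in S\}$, is a $\lambda$-boolean algebra over $\mathcal{M}^{cof}$. Let $|\cdot|_X:\mathbb{L}^{\mathcal{M}}_\lambda\to\mathcal{P}(\mathrm{Hom}(-,X))$ be the unique morphism. For $v:c\to X$, $X\vdash\phi(v)$ means $v\in|\phi|_X$. *)

theory Defs
  imports Main "HOL-Library.FuncSet" "HOL-Algebra.Galois_Connection"
begin

section \<open>Categories\<close>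

text \<open>Hom-sets are carved out of one carrier of arrows. \<^term>\<open>Comp C g f\<close> is ``g after f''.\<close>

record ('o, 'm) cat_struct =
  Obj  :: "'o set"
  Arr  :: "'m set"
  Dom  :: "'m \<Rightarrow> 'o"
  Cod  :: "'m \<Rightarrow> 'o"
  Id   :: "'o \<Rightarrow> 'm"
  Comp :: "'m \<Rightarrow> 'm \<Rightarrow> 'm"  (infixr \<open>\<cdot>\<index>\<close> 70)

definition Hom :: "('o, 'm, 'z) cat_struct_scheme \<Rightarrow> 'o \<Rightarrow> 'o \<Rightarrow> 'm set" where
  "Hom C A B = {f \<in> Arr C. Dom C f = A \<and> Cod C f = B}"

locale category =
  fixes C :: "('o, 'm, 'z) cat_struct_scheme" (structure)
  assumes Dom_Obj: "f \<in> Arr C \<Longrightarrow> Dom C f \<in> Obj C"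
    and Cod_Obj: "f \<in> Arr C \<Longrightarrow> Cod C f \<in> Obj C"
    and Id_Hom: "A \<in> Obj C \<Longrightarrow> Id C A \<in> Hom C A A"
    and Comp_Hom: "f \<in> Hom C A B \<Longrightarrow> g \<in> Hom C B D \<Longrightarrow> g \<cdot> f \<in> Hom C A D"
    and Comp_Id: "f \<in> Hom C A B \<Longrightarrow> f \<cdot> Id C A = f"
    and Id_Comp: "f \<in> Hom C A B \<Longrightarrow> Id C B \<cdot> f = f"
    and Comp_assoc: "f \<in> Hom C A B \<Longrightarrow> g \<in> Hom C B D \<Longrightarrow> h \<in> Hom C D E \<Longrightarrow>
      h \<cdot> (g \<cdot> f) = (h \<cdot> g) \<cdot> f"

definition initial_object :: "('o, 'm, 'z) cat_struct_scheme \<Rightarrow> 'o \<Rightarrow> bool" where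
  "initial_object C Z \<longleftrightarrow> Z \<in> Obj C \<and> (\<forall>A\<in>Obj C. \<exists>!f. f \<in> Hom C Z A)"

definition terminal_object :: "('o, 'm, 'z) cat_struct_scheme \<Rightarrow> 'o \<Rightarrow> bool" where
  "terminal_object C T \<longleftrightarrow> T \<in> Obj C \<and> (\<forall>A\<in>Obj C. \<exists>!f. f \<in> Hom C A T)"

definition iso_arrow :: "('o, 'm, 'z) cat_struct_scheme \<Rightarrow> 'm \<Rightarrow> bool" where
  "iso_arrow C f \<longleftrightarrow> f \<in> Arr C \<and>
     (\<exists>g\<in>Hom C (Cod C f) (Dom C f).
        g \<cdot>\<^bsub>C\<^esub> f = Id C (Dom C f) \<and> f \<cdot>\<^bsub>C\<^esub> g = Id C (Cod C f))"

definition closed_under_arrow_iso :: "('o, 'm, 'z) cat_struct_scheme \<Rightarrow> 'm set \<Rightarrow> bool" where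
  "closed_under_arrow_iso C K \<longleftrightarrow>
     (\<forall>f\<in>K. \<forall>g\<in>Arr C. \<forall>u\<in>Hom C (Dom C f) (Dom C g). \<forall>v\<in>Hom C (Cod C f) (Cod C g).
        iso_arrow C u \<and> iso_arrow C v \<and> v \<cdot>\<^bsub>C\<^esub> f = g \<cdot>\<^bsub>C\<^esub> u \<longrightarrow> g \<in> K)"

text \<open>
  \<open>is_pushout C i f i' f'\<close>: for \<open>i : A \<rightarrow> B\<close> and \<open>f : A \<rightarrow> A'\<close>, the maps \<open>i' : A' \<rightarrow> B'\<close>
  and \<open>f' : B \<rightarrow> B'\<close> form a pushout of \<open>i\<close> along \<open>f\<close>.
\<close>

definition is_pushout ::
  "('o, 'm, 'z) cat_struct_scheme \<Rightarrow> 'm \<Rightarrow> 'm \<Rightarrow> 'm \<Rightarrow> 'm \<Rightarrow> bool" where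
  "is_pushout C i f i' f' \<longleftrightarrow>
     i \<in> Arr C \<and> f \<in> Arr C \<and> i' \<in> Arr C \<and> f' \<in> Arr C \<and>
     Dom C f = Dom C i \<and> Dom C i' = Cod C f \<and> Dom C f' = Cod C i \<and> Cod C f' = Cod C i' \<and>
     i' \<cdot>\<^bsub>C\<^esub> f = f' \<cdot>\<^bsub>C\<^esub> i \<and>
     (\<forall>Z. \<forall>a\<in>Hom C (Cod C f) Z. \<forall>b\<in>Hom C (Cod C i) Z. a \<cdot>\<^bsub>C\<^esub> f = b \<cdot>\<^bsub>C\<^esub> i \<longrightarrow>
        (\<exists>!u. u \<in> Hom C (Cod C i') Z \<and> u \<cdot>\<^bsub>C\<^esub> i' = a \<and> u \<cdot>\<^bsub>C\<^esub> f' = b))"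

text \<open>
  \<open>is_pullback C p f p' f'\<close>: for \<open>p : B \<rightarrow> A\<close> and \<open>f : A' \<rightarrow> A\<close>, the maps \<open>p' : B' \<rightarrow> A'\<close>
  and \<open>f' : B' \<rightarrow> B\<close> form a pullback of \<open>p\<close> along \<open>f\<close>.
\<close>

definition is_pullback ::
  "('o, 'm, 'z) cat_struct_scheme \<Rightarrow> 'm \<Rightarrow> 'm \<Rightarrow> 'm \<Rightarrow> 'm \<Rightarrow> bool" where
  "is_pullback C p f p' f' \<longleftrightarrow>
     p \<in> Arr C \<and> f \<in> Arr C \<and> p' \<in> Arr C \<and> f' \<in> Arr C \<and>
     Cod C f = Cod C p \<and> Cod C p' = Dom C f \<and> Cod C f' = Dom C p \<and> Dom C f' = Dom C p' \<and>
     f \<cdot>\<^bsub>C\<^esub> p' = p \<cdot>\<^bsub>C\<^esub> f' \<and>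
     (\<forall>Z. \<forall>a\<in>Hom C Z (Dom C f). \<forall>b\<in>Hom C Z (Dom C p). f \<cdot>\<^bsub>C\<^esub> a = p \<cdot>\<^bsub>C\<^esub> b \<longrightarrow>
        (\<exists>!u. u \<in> Hom C Z (Dom C p') \<and> p' \<cdot>\<^bsub>C\<^esub> u = a \<and> f' \<cdot>\<^bsub>C\<^esub> u = b))"

text \<open>\<open>in1 : A \<rightarrow> S\<close> and \<open>in2 : B \<rightarrow> S\<close> exhibit \<open>S\<close> as a coproduct of \<open>A\<close> and \<open>B\<close>.\<close>

definition is_coproduct ::
  "('o, 'm, 'z) cat_struct_scheme \<Rightarrow> 'o \<Rightarrow> 'o \<Rightarrow> 'o \<Rightarrow> 'm \<Rightarrow> 'm \<Rightarrow> bool" where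
  "is_coproduct C A B S in1 in2 \<longleftrightarrow>
     in1 \<in> Hom C A S \<and> in2 \<in> Hom C B S \<and>
     (\<forall>Z. \<forall>a\<in>Hom C A Z. \<forall>b\<in>Hom C B Z.
        \<exists>!u. u \<in> Hom C S Z \<and> u \<cdot>\<^bsub>C\<^esub> in1 = a \<and> u \<cdot>\<^bsub>C\<^esub> in2 = b)"

definition has_lifting :: "('o, 'm, 'z) cat_struct_scheme \<Rightarrow> 'm \<Rightarrow> 'm \<Rightarrow> bool" where
  "has_lifting C i p \<longleftrightarrow>
     (\<forall>u\<in>Hom C (Dom C i) (Dom C p). \<forall>v\<in>Hom C (Cod C i) (Cod C p).
        p \<cdot>\<^bsub>C\<^esub> u = v \<cdot>\<^bsub>C\<^esub> i \<longrightarrow>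
        (\<exists>h\<in>Hom C (Cod C i) (Dom C p). h \<cdot>\<^bsub>C\<^esub> i = u \<and> p \<cdot>\<^bsub>C\<^esub> h = v))"


section \<open>Weak model categories\<close>

record ('o, 'm) model_struct = "('o, 'm) cat_struct" +
  Cofs :: "'m set"
  Fibs :: "'m set"
  Weqs :: "'m set"

definition cofibrant :: "('o, 'm) model_struct \<Rightarrow> 'o \<Rightarrow> bool" where
  "cofibrant M X \<longleftrightarrow> X \<in> Obj M \<and> (\<exists>Z. initial_object M Z \<and> (\<exists>f\<in>Hom M Z X. f \<in> Cofs M))"

definition fibrant :: "('o, 'm) model_struct \<Rightarrow> 'o \<Rightarrow> bool" where
  "fibrant M X \<longleftrightarrow> X \<in> Obj M \<and> (\<exists>T. terminal_object M T \<and> (\<exists>f\<in>Hom M X T. f \<in> Fibs M))"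

abbreviation fib_or_cof :: "('o, 'm) model_struct \<Rightarrow> 'o \<Rightarrow> bool" where
  "fib_or_cof M X \<equiv> fibrant M X \<or> cofibrant M X"

locale weak_model_category = category M
  for M :: "('o, 'm) model_struct" (structure) +
  assumes Cofs_Arr: "Cofs M \<subseteq> Arr M"
    and Fibs_Arr: "Fibs M \<subseteq> Arr M"
    and Weqs_Arr: "Weqs M \<subseteq> Arr M"
    and initial_ex: "\<exists>Z. initial_object M Z \<and> Id M Z \<in> Cofs M"
    and terminal_ex: "\<exists>T. terminal_object M T \<and> Id M T \<in> Fibs M"
    and Cofs_Comp: "\<lbrakk>f \<in> Hom M A B; g \<in> Hom M B D; f \<in> Cofs M; g \<in> Cofs M; cofibrant M A\<rbrakk>
      \<Longrightarrow> g \<cdot> f \<in> Cofs M"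
    and Fibs_Comp: "\<lbrakk>f \<in> Hom M A B; g \<in> Hom M B D; f \<in> Fibs M; g \<in> Fibs M; fibrant M D\<rbrakk>
      \<Longrightarrow> g \<cdot> f \<in> Fibs M"
    and two_out_of_three:
      "\<lbrakk>f \<in> Hom M A B; g \<in> Hom M B D; fib_or_cof M A; fib_or_cof M B; fib_or_cof M D\<rbrakk> \<Longrightarrow>
        (f \<in> Weqs M \<and> g \<in> Weqs M \<longrightarrow> g \<cdot> f \<in> Weqs M) \<and>
        (f \<in> Weqs M \<and> g \<cdot> f \<in> Weqs M \<longrightarrow> g \<in> Weqs M) \<and>
        (g \<in> Weqs M \<and> g \<cdot> f \<in> Weqs M \<longrightarrow> f \<in> Weqs M)"
    and iso_Weqs: "\<lbrakk>f \<in> Hom M A B; iso_arrow M f; fib_or_cof M A; fib_or_cof M B\<rbrakk>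
      \<Longrightarrow> f \<in> Weqs M"
    and pushout_Cofs: "\<lbrakk>i \<in> Hom M A D; i \<in> Cofs M; f \<in> Hom M A B; cofibrant M A; cofibrant M B\<rbrakk>
      \<Longrightarrow> \<exists>i' f'. is_pushout M i f i' f' \<and> i' \<in> Cofs M"
    and pullback_Fibs: "\<lbrakk>p \<in> Hom M D A; p \<in> Fibs M; f \<in> Hom M B A; fibrant M A; fibrant M B\<rbrakk>
      \<Longrightarrow> \<exists>p' f'. is_pullback M p f p' f' \<and> p' \<in> Fibs M"
    and Cofs_iso: "closed_under_arrow_iso M (Cofs M)"
    and Fibs_iso: "closed_under_arrow_iso M (Fibs M)"
    and Weqs_iso: "closed_under_arrow_iso M (Weqs M)"
    and factor_Cof_tFib: "\<lbrakk>f \<in> Hom M A X; cofibrant M A; fibrant M X\<rbrakk> \<Longrightarrow>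
      \<exists>Y. \<exists>i\<in>Hom M A Y. \<exists>p\<in>Hom M Y X.
        i \<in> Cofs M \<and> p \<in> Fibs M \<inter> Weqs M \<and> p \<cdot> i = f"
    and factor_tCof_Fib: "\<lbrakk>f \<in> Hom M A X; cofibrant M A; fibrant M X\<rbrakk> \<Longrightarrow>
      \<exists>Y. \<exists>i\<in>Hom M A Y. \<exists>p\<in>Hom M Y X.
        i \<in> Cofs M \<inter> Weqs M \<and> p \<in> Fibs M \<and> p \<cdot> i = f"
    and lifting: "\<lbrakk>i \<in> Hom M A B; i \<in> Cofs M; cofibrant M A; cofibrant M B;
        p \<in> Hom M X Y; p \<in> Fibs M; fibrant M X; fibrant M Y; i \<in> Weqs M \<or> p \<in> Weqs M\<rbrakk>
      \<Longrightarrow> has_lifting M i p"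


section \<open>Homotopy\<close>

text \<open>
  \<open>(S, in1, in2)\<close> is a coproduct \<open>c \<squnion> c\<close>, \<open>nabla\<close> its codiagonal, \<open>j : S \<rightarrow> Ic\<close>,
  \<open>d : c \<rightarrow> Dc\<close> and \<open>w : Ic \<rightarrow> Dc\<close>.
\<close>

definition weak_cylinder ::
  "('o, 'm) model_struct \<Rightarrow> 'o \<Rightarrow> 'o \<Rightarrow> 'm \<Rightarrow> 'm \<Rightarrow> 'o \<Rightarrow> 'o \<Rightarrow> 'm \<Rightarrow> 'm \<Rightarrow> 'm \<Rightarrow> bool" where
  "weak_cylinder M c S in1 in2 Ic Dc j d w \<longleftrightarrow>
     is_coproduct M c c S in1 in2 \<and>
     j \<in> Hom M S Ic \<and> j \<in> Cofs M \<and>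
     d \<in> Hom M c Dc \<and> d \<in> Cofs M \<inter> Weqs M \<and>
     w \<in> Hom M Ic Dc \<and> w \<in> Weqs M \<and>
     (\<exists>nabla\<in>Hom M S c. nabla \<cdot>\<^bsub>M\<^esub> in1 = Id M c \<and> nabla \<cdot>\<^bsub>M\<^esub> in2 = Id M c \<and>
        w \<cdot>\<^bsub>M\<^esub> j = d \<cdot>\<^bsub>M\<^esub> nabla)"

definition homotopic :: "('o, 'm) model_struct \<Rightarrow> 'o \<Rightarrow> 'o \<Rightarrow> 'm \<Rightarrow> 'm \<Rightarrow> bool" where
  "homotopic M c X v1 v2 \<longleftrightarrow>
     v1 \<in> Hom M c X \<and> v2 \<in> Hom M c X \<and>
     (\<exists>S in1 in2 Ic Dc j d w. weak_cylinder M c S in1 in2 Ic Dc j d w \<and>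
        (\<exists>h\<in>Hom M Ic X. (h \<cdot>\<^bsub>M\<^esub> j) \<cdot>\<^bsub>M\<^esub> in1 = v1 \<and> (h \<cdot>\<^bsub>M\<^esub> j) \<cdot>\<^bsub>M\<^esub> in2 = v2))"


section \<open>Boolean algebras with small joins\<close>

unbundle cardinal_syntax

text \<open>
  A cardinal is a cardinal order \<open>lam\<close> in the sense of the BNF cardinal library. The join of a
  family depends only on its range, and the range of a \<open>lam\<close>-small family is \<open>lam\<close>-small, so
  families are represented by subsets.
\<close>

locale boolean_lattice = bounded_lattice +
  assumes distrib: "\<lbrakk>x \<in> carrier L; y \<in> carrier L; z \<in> carrier L\<rbrakk>
      \<Longrightarrow> x \<sqinter> (y \<squnion> z) = (x \<sqinter> y) \<squnion> (x \<sqinter> z)"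
    and complement_ex: "x \<in> carrier L \<Longrightarrow> \<exists>y\<in>carrier L. x \<sqinter> y = \<bottom> \<and> x \<squnion> y = \<top>"

definition small_boolean :: "'k rel \<Rightarrow> 'b gorder \<Rightarrow> bool" where
  "small_boolean lam L \<longleftrightarrow> boolean_lattice L \<and>
     (\<forall>A. A \<subseteq> carrier L \<and> |A| <o lam \<longrightarrow> (\<exists>s. least L s (Upper L A)))"

definition small_boolean_hom :: "'k rel \<Rightarrow> 'b gorder \<Rightarrow> 'c gorder \<Rightarrow> ('b \<Rightarrow> 'c) \<Rightarrow> bool" where
  "small_boolean_hom lam K L h \<longleftrightarrow>
     h \<in> carrier K \<rightarrow> carrier L \<and>
     h \<top>\<^bsub>K\<^esub> = \<top>\<^bsub>L\<^esub> \<and> h \<bottom>\<^bsub>K\<^esub> = \<bottom>\<^bsub>L\<^esub> \<and>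
     (\<forall>x\<in>carrier K. \<forall>y\<in>carrier K.
        h (x \<sqinter>\<^bsub>K\<^esub> y) = h x \<sqinter>\<^bsub>L\<^esub> h y \<and> h (x \<squnion>\<^bsub>K\<^esub> y) = h x \<squnion>\<^bsub>L\<^esub> h y) \<and>
     (\<forall>A. A \<subseteq> carrier K \<and> |A| <o lam \<longrightarrow> h (\<Squnion>\<^bsub>K\<^esub> A) = \<Squnion>\<^bsub>L\<^esub> (h ` A))"


section \<open>Boolean algebras over the cofibrant objects, and the language\<close>

text \<open>
  \<open>reindex B f\<close> is \<open>f\<^sup>*\<close> and \<open>ex_along B i\<close> is its left adjoint. The latter is
  recorded as data, but it is determined on the carriers by the adjunction, so this is the same
  as requiring its existence.
\<close>

record ('o, 'm, 'b) cof_algebra =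
  algebra_at :: "'o \<Rightarrow> 'b gorder"
  reindex    :: "'m \<Rightarrow> 'b \<Rightarrow> 'b"
  ex_along   :: "'m \<Rightarrow> 'b \<Rightarrow> 'b"

definition boolean_over_cof ::
  "('o, 'm) model_struct \<Rightarrow> 'k rel \<Rightarrow> ('o, 'm, 'b) cof_algebra \<Rightarrow> bool" where
  "boolean_over_cof M lam B \<longleftrightarrow>
     (\<forall>c. cofibrant M c \<longrightarrow> small_boolean lam (algebra_at B c)) \<and>
     (\<forall>c d. \<forall>f\<in>Hom M c d. cofibrant M c \<and> cofibrant M d \<longrightarrow>
        small_boolean_hom lam (algebra_at B c) (algebra_at B d) (reindex B f)) \<and>
     (\<forall>c. cofibrant M c \<longrightarrow>
        (\<forall>x\<in>carrier (algebra_at B c). reindex B (Id M c) x = x)) \<and>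
     (\<forall>c d e. \<forall>f\<in>Hom M c d. \<forall>g\<in>Hom M d e.
        cofibrant M c \<and> cofibrant M d \<and> cofibrant M e \<longrightarrow>
        (\<forall>x\<in>carrier (algebra_at B c). reindex B (g \<cdot>\<^bsub>M\<^esub> f) x = reindex B g (reindex B f x))) \<and>
     (\<forall>c d. \<forall>i\<in>Hom M c d. i \<in> Cofs M \<and> cofibrant M c \<and> cofibrant M d \<longrightarrow>
        galois_connection \<lparr>orderA = algebra_at B d, orderB = algebra_at B c,
          lower = ex_along B i, upper = reindex B i\<rparr>) \<and>
     (\<forall>i f i' f'. is_pushout M i f i' f' \<and> i \<in> Cofs M \<and>
        cofibrant M (Dom M i) \<and> cofibrant M (Cod M i) \<and> cofibrant M (Cod M f) \<longrightarrow>
        (\<forall>x\<in>carrier (algebra_at B (Cod M i)).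
           reindex B f (ex_along B i x) = ex_along B i' (reindex B f' x)))"

text \<open>
  Components are extensional functions, so that a morphism is determined as a HOL function by
  its values on the carriers.
\<close>

definition cof_algebra_morphisms ::
  "('o, 'm) model_struct \<Rightarrow> 'k rel \<Rightarrow> ('o, 'm, 'b) cof_algebra \<Rightarrow> ('o, 'm, 'c) cof_algebra
    \<Rightarrow> ('o \<Rightarrow> 'b \<Rightarrow> 'c) set" where
  "cof_algebra_morphisms M lam A B =
     {h \<in> (\<Pi>\<^sub>E c\<in>Collect (cofibrant M). carrier (algebra_at A c) \<rightarrow>\<^sub>E carrier (algebra_at B c)).
        (\<forall>c. cofibrant M c \<longrightarrow> small_boolean_hom lam (algebra_at A c) (algebra_at B c) (h c)) \<and>
        (\<forall>c d. \<forall>f\<in>Hom M c d. cofibrant M c \<and> cofibrant M d \<longrightarrow>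
           (\<forall>x\<in>carrier (algebra_at A c). h d (reindex A f x) = reindex B f (h c x))) \<and>
        (\<forall>c d. \<forall>i\<in>Hom M c d. i \<in> Cofs M \<and> cofibrant M c \<and> cofibrant M d \<longrightarrow>
           (\<forall>x\<in>carrier (algebra_at A d). h c (ex_along A i x) = ex_along B i (h d x)))}"

text \<open>
  Initiality of \<open>L\<close> among the algebras over the cofibrant objects with elements in the type \<open>'b\<close>.
  HOL cannot quantify over all types at once, so the universe of test algebras is a parameter;
  \<open>L\<close> itself may live in any other (larger) type. An algebra that is initial in a larger universe
  is initial in this sense, so as a hypothesis this is no stronger than full initiality; for
  \<open>|_|\<^sub>X\<close> below to be well defined the type \<open>'m set\<close> of sets of arrows suffices.
\<close>

definition initial_boolean_over_cof ::
  "'b itself \<Rightarrow> ('o, 'm) model_struct \<Rightarrow> 'k rel \<Rightarrow> ('o, 'm, 'l) cof_algebra \<Rightarrow> bool" where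
  "initial_boolean_over_cof _ M lam L \<longleftrightarrow>
     boolean_over_cof M lam L \<and>
     (\<forall>B :: ('o, 'm, 'b) cof_algebra. boolean_over_cof M lam B \<longrightarrow>
        (\<exists>!h. h \<in> cof_algebra_morphisms M lam L B))"


section \<open>Validity\<close>

definition hom_powerset :: "('o, 'm) model_struct \<Rightarrow> 'o \<Rightarrow> ('o, 'm, 'm set) cof_algebra" where
  "hom_powerset M X =
     \<lparr>algebra_at = (\<lambda>c. \<lparr>carrier = Pow (Hom M c X), eq = (=), le = (\<subseteq>)\<rparr>),
      reindex = (\<lambda>g S. {v \<in> Hom M (Cod M g) X. v \<cdot>\<^bsub>M\<^esub> g \<in> S}),
      ex_along = (\<lambda>i S. {v \<cdot>\<^bsub>M\<^esub> i | v. v \<in> S})\<rparr>"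

definition interp ::
  "('o, 'm) model_struct \<Rightarrow> 'k rel \<Rightarrow> ('o, 'm, 'l) cof_algebra \<Rightarrow> 'o \<Rightarrow> 'o \<Rightarrow> 'l \<Rightarrow> 'm set" where
  "interp M lam L X = (THE h. h \<in> cof_algebra_morphisms M lam L (hom_powerset M X))"

text \<open>\<open>valid M lam L X c phi v\<close> is \<open>X \<turnstile> phi(v)\<close> for a formula \<open>phi\<close> in context \<open>c\<close>.\<close>

definition valid ::
  "('o, 'm) model_struct \<Rightarrow> 'k rel \<Rightarrow> ('o, 'm, 'l) cof_algebra \<Rightarrow> 'o \<Rightarrow> 'o \<Rightarrow> 'l \<Rightarrow> 'm \<Rightarrow> bool" where
  "valid M lam L X c phi v \<longleftrightarrow> v \<in> interp M lam L X c phi"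

end

theory Submission
  imports Defs
begin

text \<open>
  Let \<open>f : X \<rightarrow> Y\<close> be a trivial fibration between fibrant objects. Lifting cofibrations against \<open>f\<close>
  says exactly that taking preimages along \<open>f\<close> commutes with every \<open>\<exists>\<^sub>i\<close>, so it is a morphism from the
  power set algebra of \<open>Y\<close> to that of \<open>X\<close>, and by initiality of the language \<open>f\<close> preserves and
  reflects validity. Everything else is reduced to this case. A fibrant object has a cofibrant
  replacement by a trivial fibration, to which maps from cofibrant objects lift. For a weak
  equivalence \<open>f : X \<rightarrow> Y\<close> with \<open>X\<close> bifibrant, factor \<open>(id, f) : X \<rightarrow> X \<times> Y\<close> as a trivial cofibration
  \<open>X \<rightarrow> W\<close> and a fibration; both projections \<open>W \<rightarrow> X\<close> and \<open>W \<rightarrow> Y\<close> are then trivial fibrations, and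
  \<open>v\<close> and \<open>f \<circ> v\<close> are the two projections of one map into \<open>W\<close>. Homotopic maps into a bifibrant \<open>X\<close>
  are likewise the two projections of one map into the path object \<open>W\<close> obtained from \<open>f = id\<close>.
\<close>

section \<open>Power sets as boolean algebras with small joins\<close>

abbreviation powerset_order :: "'a set \<Rightarrow> 'a set gorder" where
  "powerset_order A \<equiv> \<lparr>carrier = Pow A, eq = (=), le = (\<subseteq>)\<rparr>"

lemma powerset_sup:
  assumes "F \<subseteq> Pow A"
  shows "\<Squnion>\<^bsub>powerset_order A\<^esub> F = \<Union>F"
proof -
  interpret complete_lattice "powerset_order A" by (rule powerset_is_complete_lattice)
  have "least (powerset_order A) (\<Union>F) (Upper (powerset_order A) F)"
    using assms by (fastforce intro!: least_UpperI simp: Upper_def)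
  then show ?thesis
    using sup_lub[of F] assms least_unique by simp
qed

lemma powerset_join: "S \<subseteq> A \<Longrightarrow> T \<subseteq> A \<Longrightarrow> S \<squnion>\<^bsub>powerset_order A\<^esub> T = S \<union> T"
  by (simp add: join_def powerset_sup)

lemma powerset_meet:
  assumes "S \<subseteq> A" "T \<subseteq> A"
  shows "S \<sqinter>\<^bsub>powerset_order A\<^esub> T = S \<inter> T"
proof -
  interpret complete_lattice "powerset_order A" by (rule powerset_is_complete_lattice)
  have "greatest (powerset_order A) (S \<inter> T) (Lower (powerset_order A) {S, T})"
    using assms by (fastforce intro!: greatest_LowerI simp: Lower_def)
  then show ?thesis
    using inf_glb[of "{S, T}"] assms greatest_unique by (simp add: meet_def)
qed

lemma powerset_top: "\<top>\<^bsub>powerset_order A\<^esub> = A"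
proof -
  interpret complete_lattice "powerset_order A" by (rule powerset_is_complete_lattice)
  show ?thesis using top_higher[of A] top_closed by auto
qed

lemma powerset_bottom: "\<bottom>\<^bsub>powerset_order A\<^esub> = {}"
proof -
  interpret complete_lattice "powerset_order A" by (rule powerset_is_complete_lattice)
  show ?thesis using bottom_lower[of "{}"] bottom_closed by auto
qed

lemmas powerset_order_ops = powerset_sup powerset_join powerset_meet powerset_top powerset_bottom

lemma small_boolean_powerset: "small_boolean lam (powerset_order A)"
proof -
  interpret complete_lattice "powerset_order A" by (rule powerset_is_complete_lattice)
  have "boolean_lattice (powerset_order A)"
  proof
    fix S assume "S \<in> carrier (powerset_order A)"
    then have "A - S \<in> carrier (powerset_order A) \<and> S \<sqinter>\<^bsub>powerset_order A\<^esub> (A - S) = {}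
        \<and> S \<squnion>\<^bsub>powerset_order A\<^esub> (A - S) = A"
      by (auto simp: powerset_order_ops)
    then show "\<exists>T\<in>carrier (powerset_order A). S \<sqinter>\<^bsub>powerset_order A\<^esub> T = \<bottom>\<^bsub>powerset_order A\<^esub>
        \<and> S \<squnion>\<^bsub>powerset_order A\<^esub> T = \<top>\<^bsub>powerset_order A\<^esub>"
      by (metis powerset_bottom powerset_top)
  next
    fix S T U
    assume "S \<in> carrier (powerset_order A)" "T \<in> carrier (powerset_order A)"
      "U \<in> carrier (powerset_order A)"
    moreover from this have "S \<inter> T \<subseteq> A" "S \<inter> U \<subseteq> A" "T \<union> U \<subseteq> A" by auto
    ultimately show "S \<sqinter>\<^bsub>powerset_order A\<^esub> (T \<squnion>\<^bsub>powerset_order A\<^esub> U) =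
        (S \<sqinter>\<^bsub>powerset_order A\<^esub> T) \<squnion>\<^bsub>powerset_order A\<^esub> (S \<sqinter>\<^bsub>powerset_order A\<^esub> U)"
      by (simp add: powerset_join powerset_meet Int_Un_distrib)
  qed
  then show ?thesis
    unfolding small_boolean_def using sup_exists by blast
qed

text \<open>Preimages commute with arbitrary unions and with intersections. Both kinds of map
  between hom power sets that occur below have this form: reindexing, for precomposition with a map
  of contexts, and the comparison along a map \<open>f\<close>, for postcomposition with
  \<open>f\<close>.\<close>

lemma small_boolean_hom_preimage:
  assumes "g \<in> U \<rightarrow> V"
  shows "small_boolean_hom lam (powerset_order V) (powerset_order U) (\<lambda>S. {u \<in> U. g u \<in> S})"
proof -
  have "{u \<in> U. g u \<in> \<Union>F} = \<Squnion>\<^bsub>powerset_order U\<^esub> ((\<lambda>S. {u \<in> U. g u \<in> S}) ` F)" for F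
    by (subst powerset_sup) auto
  moreover have "{u \<in> U. g u \<in> S} \<subseteq> U" for S by auto
  ultimately show ?thesis
    unfolding small_boolean_hom_def using assms by (auto simp: powerset_order_ops)
qed

lemma small_boolean_hom_comp:
  assumes "small_boolean_hom lam A B h" "small_boolean_hom lam B D k"
  shows "small_boolean_hom lam A D (\<lambda>x. k (h x))"
proof -
  have closed: "h x \<in> carrier B" if "x \<in> carrier A" for x
    using assms(1) that by (auto simp: small_boolean_hom_def)
  have "k (h (\<Squnion>\<^bsub>A\<^esub> F)) = \<Squnion>\<^bsub>D\<^esub> ((\<lambda>x. k (h x)) ` F)" if "F \<subseteq> carrier A" "|F| <o lam" for F
  proof -
    have "|h ` F| <o lam" using card_of_image that(2) by (rule ordLeq_ordLess_trans)
    moreover have "h ` F \<subseteq> carrier B" using that closed by auto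
    ultimately show ?thesis
      using assms that unfolding small_boolean_hom_def by (simp add: image_image)
  qed
  then show ?thesis
    using assms closed unfolding small_boolean_hom_def by (auto simp: Pi_iff)
qed

text \<open>Components of morphisms are extensional, so a composite has to be cut down to the
  carrier. This alters none of the required equations, because the carrier of \<open>A\<close>
  contains the bounds, the meets and joins of its elements, and the joins of its small
  families.\<close>

lemma small_boolean_hom_restrict:
  assumes A: "small_boolean lam A" and h: "small_boolean_hom lam A B h"
  shows "small_boolean_hom lam A B (restrict h (carrier A))"
proof -
  interpret boolean_lattice A using A by (simp add: small_boolean_def)
  have "\<Squnion>\<^bsub>A\<^esub> F \<in> carrier A" if "F \<subseteq> carrier A" "|F| <o lam" for F
  proof -
    have "\<exists>s. least A s (Upper A F)" using A that by (auto simp: small_boolean_def)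
    then show ?thesis unfolding sup_def by (metis someI_ex least_closed)
  qed
  moreover have "restrict h (carrier A) ` F = h ` F" if "F \<subseteq> carrier A" for F
    using that by (auto simp: image_def subset_iff)
  ultimately show ?thesis
    using h unfolding small_boolean_hom_def by (simp add: Pi_iff)
qed

text \<open>Serves to produce a second morphism out of the language, to be compared with the
  interpretation by uniqueness. The family \<open>k\<close> only has to behave like a morphism on
  the carriers; the composite is made extensional by restriction.\<close>

lemma cof_algebra_morphisms_comp:
  assumes A: "boolean_over_cof M lam A" and h: "h \<in> cof_algebra_morphisms M lam A B"
    and k: "\<And>c. cofibrant M c \<Longrightarrow>
      small_boolean_hom lam (algebra_at B c) (algebra_at D c) (k c)"
    and k_reindex: "\<And>c d f x. f \<in> Hom M c d \<Longrightarrow> cofibrant M c \<Longrightarrow> cofibrant M d \<Longrightarrow>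
      x \<in> carrier (algebra_at B c) \<Longrightarrow> k d (reindex B f x) = reindex D f (k c x)"
    and k_ex: "\<And>c d i x. i \<in> Hom M c d \<Longrightarrow> i \<in> Cofs M \<Longrightarrow> cofibrant M c \<Longrightarrow> cofibrant M d \<Longrightarrow>
      x \<in> carrier (algebra_at B d) \<Longrightarrow> k c (ex_along B i x) = ex_along D i (k d x)"
  shows "(\<lambda>c\<in>Collect (cofibrant M). \<lambda>x\<in>carrier (algebra_at A c). k c (h c x))
    \<in> cof_algebra_morphisms M lam A D"
proof -
  have A_hom: "\<forall>c d. \<forall>f\<in>Hom M c d. cofibrant M c \<and> cofibrant M d \<longrightarrow>
      small_boolean_hom lam (algebra_at A c) (algebra_at A d) (reindex A f)"
    and A_galois: "\<forall>c d. \<forall>i\<in>Hom M c d. i \<in> Cofs M \<and> cofibrant M c \<and> cofibrant M d \<longrightarrow>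
      galois_connection \<lparr>orderA = algebra_at A d, orderB = algebra_at A c,
        lower = ex_along A i, upper = reindex A i\<rparr>"
    and A_small: "\<forall>c. cofibrant M c \<longrightarrow> small_boolean lam (algebra_at A c)"
    using A unfolding boolean_over_cof_def by - (elim conjE, assumption)+
  have hc: "h c x \<in> carrier (algebra_at B c)"
    if "cofibrant M c" "x \<in> carrier (algebra_at A c)" for c x
    using h that by (auto simp: cof_algebra_morphisms_def small_boolean_hom_def)
  have kc: "k c x \<in> carrier (algebra_at D c)"
    if "cofibrant M c" "x \<in> carrier (algebra_at B c)" for c x
    using k[OF that(1)] that by (auto simp: small_boolean_hom_def)
  \<comment> \<open>Reindexing and quantification stay inside the carriers of \<open>A\<close>, so
    the restrictions in the composite are invisible in the two naturality conditions. For
    \<open>ex_along\<close> this closure comes from the Galois connection.\<close>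
  have re: "reindex A f x \<in> carrier (algebra_at A d)"
    if "f \<in> Hom M c d" "cofibrant M c" "cofibrant M d" "x \<in> carrier (algebra_at A c)" for c d f x
  proof -
    have "small_boolean_hom lam (algebra_at A c) (algebra_at A d) (reindex A f)"
      using A_hom that by blast
    then show ?thesis using that unfolding small_boolean_hom_def by blast
  qed
  have ex: "ex_along A i x \<in> carrier (algebra_at A c)"
    if "i \<in> Hom M c d" "i \<in> Cofs M" "cofibrant M c" "cofibrant M d"
      "x \<in> carrier (algebra_at A d)" for c d i x
  proof -
    have "galois_connection \<lparr>orderA = algebra_at A d, orderB = algebra_at A c,
          lower = ex_along A i, upper = reindex A i\<rparr>"
      using A_galois that by blast
    from connection.lower_closed[OF galois_connection.axioms(1)[OF this]] that show ?thesis by simp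
  qed
  have hom: "small_boolean_hom lam (algebra_at A c) (algebra_at D c)
      (\<lambda>x\<in>carrier (algebra_at A c). k c (h c x))" if "cofibrant M c" for c
  proof (rule small_boolean_hom_restrict)
    show "small_boolean lam (algebra_at A c)" using A_small that by blast
    have "small_boolean_hom lam (algebra_at A c) (algebra_at B c) (h c)"
      using h that unfolding cof_algebra_morphisms_def by blast
    then show "small_boolean_hom lam (algebra_at A c) (algebra_at D c) (\<lambda>x. k c (h c x))"
      using k[OF that] by (rule small_boolean_hom_comp)
  qed
  have h_reindex: "h d (reindex A f x) = reindex B f (h c x)"
    if "f \<in> Hom M c d" "cofibrant M c" "cofibrant M d" "x \<in> carrier (algebra_at A c)" for c d f x
    using h that unfolding cof_algebra_morphisms_def by blast
  have h_ex: "h c (ex_along A i x) = ex_along B i (h d x)"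
    if "i \<in> Hom M c d" "i \<in> Cofs M" "cofibrant M c" "cofibrant M d"
      "x \<in> carrier (algebra_at A d)" for c d i x
    using h that unfolding cof_algebra_morphisms_def by blast
  show ?thesis
    unfolding cof_algebra_morphisms_def mem_Collect_eq
  proof (intro conjI PiE_I allI ballI impI)
    fix c d f x
    assume "f \<in> Hom M c d" "cofibrant M c \<and> cofibrant M d" "x \<in> carrier (algebra_at A c)"
    then show "(\<lambda>c\<in>Collect (cofibrant M). \<lambda>x\<in>carrier (algebra_at A c). k c (h c x)) d (reindex A f x)
      = reindex D f ((\<lambda>c\<in>Collect (cofibrant M). \<lambda>x\<in>carrier (algebra_at A c). k c (h c x)) c x)"
      using re[of f c d x] k_reindex[of f c d "h c x"] h_reindex[of f c d x] hc[of c x] by simp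
  next
    fix c d i x
    assume "i \<in> Hom M c d" "i \<in> Cofs M \<and> cofibrant M c \<and> cofibrant M d"
      "x \<in> carrier (algebra_at A d)"
    then show "(\<lambda>c\<in>Collect (cofibrant M). \<lambda>x\<in>carrier (algebra_at A c). k c (h c x)) c (ex_along A i x)
      = ex_along D i ((\<lambda>c\<in>Collect (cofibrant M). \<lambda>x\<in>carrier (algebra_at A c). k c (h c x)) d x)"
      using ex[of i c d x] k_ex[of i c d "h d x"] h_ex[of i c d x] hc[of d x] by simp
  qed (simp_all add: hc kc hom)
qed

section \<open>Validity along trivial fibrations\<close>

lemma (in category) Hom_Obj: "f \<in> Hom C A B \<Longrightarrow> A \<in> Obj C" "f \<in> Hom C A B \<Longrightarrow> B \<in> Obj C"
  using Dom_Obj Cod_Obj by (auto simp: Hom_def)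

context weak_model_category
begin

text \<open>By the universal property of the pushout, a pair \<open>v\<close>, \<open>w\<close> that
  agrees on the common domain of \<open>f\<close> and \<open>i\<close> is the same as one map
  \<open>u\<close> out of the pushout. Asking for such a \<open>w\<close> in \<open>S\<close> is
  therefore asking for a \<open>u\<close> with \<open>u \<cdot> f'\<close> in
  \<open>S\<close>.\<close>

lemma ex_along_reindex:
  assumes po: "is_pushout M i f i' f'" and S: "S \<subseteq> Hom M (Cod M i) X"
  shows "{v \<in> Hom M (Cod M f) X. v \<cdot> f \<in> {w \<cdot> i |w. w \<in> S}} =
    {u \<cdot> i' |u. u \<in> {u \<in> Hom M (Cod M f') X. u \<cdot> f' \<in> S}}"
proof -
  have H: "i \<in> Hom M (Dom M i) (Cod M i)" "f \<in> Hom M (Dom M i) (Cod M f)"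
    "i' \<in> Hom M (Cod M f) (Cod M i')" "f' \<in> Hom M (Cod M i) (Cod M i')"
    and eq: "i' \<cdot> f = f' \<cdot> i" "Cod M f' = Cod M i'"
    and univ: "\<And>Z a b. a \<in> Hom M (Cod M f) Z \<Longrightarrow> b \<in> Hom M (Cod M i) Z \<Longrightarrow> a \<cdot> f = b \<cdot> i \<Longrightarrow>
      \<exists>u. u \<in> Hom M (Cod M i') Z \<and> u \<cdot> i' = a \<and> u \<cdot> f' = b"
    using po unfolding is_pushout_def by (auto simp: Hom_def) blast+
  show ?thesis
  proof (intro subset_antisym subsetI)
    fix v assume "v \<in> {v \<in> Hom M (Cod M f) X. v \<cdot> f \<in> {w \<cdot> i |w. w \<in> S}}"
    then obtain w where v: "v \<in> Hom M (Cod M f) X" "w \<in> S" "v \<cdot> f = w \<cdot> i" by auto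
    then obtain u where "u \<in> Hom M (Cod M i') X" "u \<cdot> i' = v" "u \<cdot> f' = w"
      using univ[of v X w] S by blast
    then show "v \<in> {u \<cdot> i' |u. u \<in> {u \<in> Hom M (Cod M f') X. u \<cdot> f' \<in> S}}"
      using v eq by auto
  next
    fix v assume "v \<in> {u \<cdot> i' |u. u \<in> {u \<in> Hom M (Cod M f') X. u \<cdot> f' \<in> S}}"
    then obtain u where u: "v = u \<cdot> i'" "u \<in> Hom M (Cod M i') X" "u \<cdot> f' \<in> S"
      using eq by auto
    have "v \<cdot> f = (u \<cdot> f') \<cdot> i"
      using Comp_assoc[OF H(2,3) u(2)] Comp_assoc[OF H(1,4) u(2)] u eq by simp
    then show "v \<in> {v \<in> Hom M (Cod M f) X. v \<cdot> f \<in> {w \<cdot> i |w. w \<in> S}}"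
      using u Comp_Hom[OF H(3) u(2)] by auto
  qed
qed

text \<open>The adjunction is the usual one between direct image and preimage, here for
  precomposition with \<open>i\<close>; the compatibility with pushouts is
  \<open>ex_along_reindex\<close>.\<close>

lemma boolean_over_cof_hom_powerset: "boolean_over_cof M lam (hom_powerset M X)"
  unfolding boolean_over_cof_def
proof (intro conjI allI impI ballI)
  let ?B = "hom_powerset M X"
  fix c
  show "small_boolean lam (algebra_at ?B c)"
    by (simp add: hom_powerset_def small_boolean_powerset)
  fix d f assume f: "f \<in> Hom M c d"
  have "(\<lambda>v. v \<cdot> f) \<in> Hom M d X \<rightarrow> Hom M c X" using f Comp_Hom by auto
  moreover have "Cod M f = d" using f by (simp add: Hom_def)
  ultimately show "small_boolean_hom lam (algebra_at ?B c) (algebra_at ?B d) (reindex ?B f)"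
    using small_boolean_hom_preimage[of "\<lambda>v. v \<cdot> f" "Hom M d X" "Hom M c X" lam]
    by (simp add: hom_powerset_def)
next
  let ?B = "hom_powerset M X"
  fix c x assume "cofibrant M c" "x \<in> carrier (algebra_at ?B c)"
  moreover from this have "Cod M (Id M c) = c" using Id_Hom[of c] by (auto simp: cofibrant_def Hom_def)
  ultimately show "reindex ?B (Id M c) x = x"
    using Comp_Id by (auto simp: hom_powerset_def)
next
  let ?B = "hom_powerset M X"
  fix c d e f g x assume fg: "f \<in> Hom M c d" "g \<in> Hom M d e" "x \<in> carrier (algebra_at ?B c)"
  moreover have "Cod M f = d" "Cod M g = e" "Cod M (g \<cdot> f) = e"
    using Comp_Hom[OF fg(1,2)] fg by (auto simp: Hom_def)
  ultimately show "reindex ?B (g \<cdot> f) x = reindex ?B g (reindex ?B f x)"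
    using Comp_assoc[OF fg(1,2)] Comp_Hom by (auto simp: hom_powerset_def)
next
  let ?B = "hom_powerset M X"
  fix c d i assume i: "i \<in> Hom M c d"
  have po: "partial_order (powerset_order (Hom M e X))" for e
    by standard auto
  have cod: "Cod M i = d" using i by (simp add: Hom_def)
  show "galois_connection \<lparr>orderA = algebra_at ?B d, orderB = algebra_at ?B c,
          lower = ex_along ?B i, upper = reindex ?B i\<rparr>"
    using po Comp_Hom[OF i] cod
    by (auto simp: galois_connection_def galois_connection_axioms_def connection_def
        hom_powerset_def)
next
  let ?B = "hom_powerset M X"
  fix i f i' f' x
  assume "is_pushout M i f i' f' \<and> i \<in> Cofs M \<and>
        cofibrant M (Dom M i) \<and> cofibrant M (Cod M i) \<and> cofibrant M (Cod M f)"
    and "x \<in> carrier (algebra_at ?B (Cod M i))"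
  then show "reindex ?B f (ex_along ?B i x) = ex_along ?B i' (reindex ?B f' x)"
    using ex_along_reindex[of i f i' f' x X] by (simp add: hom_powerset_def)
qed

context
  fixes lam :: "'k rel" and L :: "('o, 'm, 'l) cof_algebra"
  assumes L: "initial_boolean_over_cof TYPE('m set) M lam L"
begin

text \<open>Initiality is tested on \<open>hom_powerset M X\<close>, whose elements have type
  \<open>'m set\<close>; this justifies the definite description in \<open>interp\<close>.\<close>

lemma interp_unique: "\<exists>!h. h \<in> cof_algebra_morphisms M lam L (hom_powerset M X)"
  using L boolean_over_cof_hom_powerset unfolding initial_boolean_over_cof_def by blast

lemma interp_morphism: "interp M lam L X \<in> cof_algebra_morphisms M lam L (hom_powerset M X)"
  unfolding interp_def by (rule theI'[OF interp_unique])

lemma valid_trivial_fibration: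
  assumes f: "f \<in> Hom M X Y" "f \<in> Fibs M" "f \<in> Weqs M" and X: "fibrant M X" and Y: "fibrant M Y"
    and c: "cofibrant M c" and phi: "phi \<in> carrier (algebra_at L c)" and v: "v \<in> Hom M c X"
  shows "valid M lam L X c phi v \<longleftrightarrow> valid M lam L Y c phi (f \<cdot> v)"
proof -
  \<comment> \<open>\<open>k\<close> takes preimages under postcomposition with \<open>f\<close>,
    from the power set algebra of \<open>Y\<close> to that of \<open>X\<close>.\<close>
  define k where "k = (\<lambda>c S. {v \<in> Hom M c X. f \<cdot> v \<in> S})"
  let ?h = "\<lambda>c\<in>Collect (cofibrant M). \<lambda>x\<in>carrier (algebra_at L c). k c (interp M lam L Y c x)"
  have "?h \<in> cof_algebra_morphisms M lam L (hom_powerset M X)"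
  proof (rule cof_algebra_morphisms_comp[OF _ interp_morphism])
    show "boolean_over_cof M lam L" using L by (simp add: initial_boolean_over_cof_def)
    fix c assume c: "cofibrant M c"
    have "(\<lambda>v. f \<cdot> v) \<in> Hom M c X \<rightarrow> Hom M c Y" using Comp_Hom f by auto
    then show "small_boolean_hom lam (algebra_at (hom_powerset M Y) c)
        (algebra_at (hom_powerset M X) c) (k c)"
      using small_boolean_hom_preimage[of "\<lambda>v. f \<cdot> v" "Hom M c X" "Hom M c Y" lam]
      by (simp add: hom_powerset_def k_def)
    fix d g x assume g: "g \<in> Hom M c d"
    have "Cod M g = d" using g by (simp add: Hom_def)
    then show "k d (reindex (hom_powerset M Y) g x) = reindex (hom_powerset M X) g (k c x)"
      using Comp_Hom[OF g] Comp_Hom[OF _ f(1)] Comp_assoc[OF g _ f(1)]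
      by (auto simp: hom_powerset_def k_def)
  next
    fix c d i x assume i: "i \<in> Hom M c d" "i \<in> Cofs M" and cd: "cofibrant M c" "cofibrant M d"
      and x: "x \<in> carrier (algebra_at (hom_powerset M Y) d)"
    have cod: "Cod M i = d" "Dom M i = c" "Cod M f = Y" "Dom M f = X"
      using i f by (auto simp: Hom_def)
    have lift: "has_lifting M i f" using lifting i f cd X Y by blast
    \<comment> \<open>This is the inclusion that needs lifting: when \<open>f \<cdot> v\<close>
      extends along \<open>i\<close> to some \<open>w\<close> in \<open>x\<close>, a diagonal filler
      extends \<open>v\<close> itself to a map \<open>u\<close> lying over \<open>w\<close>.\<close>
    have "\<exists>u. v = u \<cdot> i \<and> u \<in> Hom M d X \<and> f \<cdot> u \<in> x"
      if vw: "v \<in> Hom M c X" "w \<in> x" "f \<cdot> v = w \<cdot> i" for v w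
    proof -
      have "w \<in> Hom M d Y" using x vw by (auto simp: hom_powerset_def)
      then obtain u where "u \<in> Hom M d X" "u \<cdot> i = v" "f \<cdot> u = w"
        using lift vw unfolding has_lifting_def cod by blast
      then show ?thesis using vw by blast
    qed
    moreover have "f \<cdot> (u \<cdot> i) = (f \<cdot> u) \<cdot> i \<and> u \<cdot> i \<in> Hom M c X" if "u \<in> Hom M d X" for u
      using Comp_assoc[OF i(1) that f(1)] Comp_Hom[OF i(1) that] by simp
    ultimately show "k c (ex_along (hom_powerset M Y) i x) = ex_along (hom_powerset M X) i (k d x)"
      by (auto simp: hom_powerset_def k_def)
  qed
  \<comment> \<open>The uniqueness half of initiality: the interpretation in \<open>X\<close> is the
    preimage of the one in \<open>Y\<close>.\<close>
  then have "?h = interp M lam L X" using interp_unique interp_morphism by blast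
  then have "interp M lam L X c phi = k c (interp M lam L Y c phi)"
    using c phi by (metis (no_types, lifting) mem_Collect_eq restrict_apply')
  then show ?thesis using v by (simp add: valid_def k_def)
qed

end

end


section \<open>Homotopy theory of fibrant and cofibrant objects\<close>

definition is_product ::
  "('o, 'm, 'z) cat_struct_scheme \<Rightarrow> 'o \<Rightarrow> 'o \<Rightarrow> 'o \<Rightarrow> 'm \<Rightarrow> 'm \<Rightarrow> bool" where
  "is_product C A B P p1 p2 \<longleftrightarrow>
     p1 \<in> Hom C P A \<and> p2 \<in> Hom C P B \<and>
     (\<forall>Z. \<forall>a\<in>Hom C Z A. \<forall>b\<in>Hom C Z B.
        \<exists>!u. u \<in> Hom C Z P \<and> p1 \<cdot>\<^bsub>C\<^esub> u = a \<and> p2 \<cdot>\<^bsub>C\<^esub> u = b)"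

lemma is_product_commute: "is_product C A B P p1 p2 \<Longrightarrow> is_product C B A P p2 p1"
  unfolding is_product_def by (auto simp: conj_commute)

context category
begin

lemma iso_arrowI:
  assumes "f \<in> Hom C A B" "g \<in> Hom C B A" "g \<cdot> f = Id C A" "f \<cdot> g = Id C B"
  shows "iso_arrow C f"
  using assms unfolding iso_arrow_def Hom_def by auto

lemma iso_arrow_Id: "A \<in> Obj C \<Longrightarrow> iso_arrow C (Id C A)"
  using iso_arrowI Id_Hom Id_Comp by metis

lemma initial_iso:
  assumes "initial_object C A" "initial_object C B" "f \<in> Hom C A B"
  shows "iso_arrow C f"
proof -
  obtain g where g: "g \<in> Hom C B A" using assms unfolding initial_object_def by blast
  have "g \<cdot> f = Id C A" "f \<cdot> g = Id C B"
    using assms Comp_Hom[OF assms(3) g] Comp_Hom[OF g assms(3)] Id_Hom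
    unfolding initial_object_def by metis+
  then show ?thesis using iso_arrowI assms(3) g by blast
qed

lemma terminal_iso:
  assumes "terminal_object C A" "terminal_object C B" "f \<in> Hom C A B"
  shows "iso_arrow C f"
proof -
  obtain g where g: "g \<in> Hom C B A" using assms unfolding terminal_object_def by blast
  have "g \<cdot> f = Id C A" "f \<cdot> g = Id C B"
    using assms Comp_Hom[OF assms(3) g] Comp_Hom[OF g assms(3)] Id_Hom
    unfolding terminal_object_def by metis+
  then show ?thesis using iso_arrowI assms(3) g by blast
qed

lemma product_mediator:
  assumes "is_product C A B P p1 p2" "a \<in> Hom C Z A" "b \<in> Hom C Z B"
  obtains u where "u \<in> Hom C Z P" "p1 \<cdot> u = a" "p2 \<cdot> u = b"
  using assms unfolding is_product_def by blast

lemma product_unique: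
  assumes P: "is_product C A B P p1 p2" and uv: "u \<in> Hom C Z P" "v \<in> Hom C Z P"
    and "p1 \<cdot> u = p1 \<cdot> v" "p2 \<cdot> u = p2 \<cdot> v"
  shows "u = v"
proof -
  have "p1 \<cdot> u \<in> Hom C Z A" "p2 \<cdot> u \<in> Hom C Z B"
    using P uv Comp_Hom unfolding is_product_def by blast+
  then have "\<exists>!w. w \<in> Hom C Z P \<and> p1 \<cdot> w = p1 \<cdot> u \<and> p2 \<cdot> w = p2 \<cdot> u"
    using P unfolding is_product_def by blast
  then show ?thesis using assms by metis
qed

text \<open>The two mediating maps are mutually inverse because the projections are jointly monic.
  Compatibility of \<open>u\<close> with the projections is recorded because it makes them
  isomorphic as arrows.\<close>

lemma product_iso:
  assumes P: "is_product C A B P p1 p2" and Q: "is_product C A B Q q1 q2"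
  obtains u where "u \<in> Hom C P Q" "iso_arrow C u" "q1 \<cdot> u = p1" "q2 \<cdot> u = p2"
proof -
  have H: "p1 \<in> Hom C P A" "p2 \<in> Hom C P B" "q1 \<in> Hom C Q A" "q2 \<in> Hom C Q B"
    using P Q by (auto simp: is_product_def)
  obtain u where u: "u \<in> Hom C P Q" "q1 \<cdot> u = p1" "q2 \<cdot> u = p2"
    using product_mediator[OF Q H(1,2)] by blast
  obtain w where w: "w \<in> Hom C Q P" "p1 \<cdot> w = q1" "p2 \<cdot> w = q2"
    using product_mediator[OF P H(3,4)] by blast
  have "w \<cdot> u = Id C P"
    using product_unique[OF P Comp_Hom[OF u(1) w(1)] Id_Hom] Hom_Obj[OF H(1)] u w
      Comp_assoc[OF u(1) w(1)] Comp_Id H by simp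
  moreover have "u \<cdot> w = Id C Q"
    using product_unique[OF Q Comp_Hom[OF w(1) u(1)] Id_Hom] Hom_Obj[OF H(3)] u w
      Comp_assoc[OF w(1) u(1)] Comp_Id H by simp
  ultimately show thesis using that u w iso_arrowI by blast
qed

lemma coproduct_mediator:
  assumes "is_coproduct C A B S i1 i2" "a \<in> Hom C A Z" "b \<in> Hom C B Z"
  obtains u where "u \<in> Hom C S Z" "u \<cdot> i1 = a" "u \<cdot> i2 = b"
  using assms unfolding is_coproduct_def by blast

lemma coproduct_unique:
  assumes S: "is_coproduct C A B S i1 i2" and uv: "u \<in> Hom C S Z" "v \<in> Hom C S Z"
    and "u \<cdot> i1 = v \<cdot> i1" "u \<cdot> i2 = v \<cdot> i2"
  shows "u = v"
proof -
  have "u \<cdot> i1 \<in> Hom C A Z" "u \<cdot> i2 \<in> Hom C B Z"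
    using S uv Comp_Hom unfolding is_coproduct_def by blast+
  then have "\<exists>!w. w \<in> Hom C S Z \<and> w \<cdot> i1 = u \<cdot> i1 \<and> w \<cdot> i2 = u \<cdot> i2"
    using S unfolding is_coproduct_def by blast
  then show ?thesis using assms by metis
qed

lemma coproduct_iso:
  assumes S: "is_coproduct C A B S i1 i2" and T: "is_coproduct C A B T j1 j2"
  obtains u where "u \<in> Hom C S T" "iso_arrow C u" "u \<cdot> i1 = j1" "u \<cdot> i2 = j2"
proof -
  have H: "i1 \<in> Hom C A S" "i2 \<in> Hom C B S" "j1 \<in> Hom C A T" "j2 \<in> Hom C B T"
    using S T by (auto simp: is_coproduct_def)
  obtain u where u: "u \<in> Hom C S T" "u \<cdot> i1 = j1" "u \<cdot> i2 = j2"
    using coproduct_mediator[OF S H(3,4)] by blast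
  obtain w where w: "w \<in> Hom C T S" "w \<cdot> j1 = i1" "w \<cdot> j2 = i2"
    using coproduct_mediator[OF T H(1,2)] by blast
  have "w \<cdot> u = Id C S"
    using coproduct_unique[OF S Comp_Hom[OF u(1) w(1)] Id_Hom] Hom_Obj[OF H(1)] u w
      Comp_assoc[OF _ u(1) w(1), symmetric] Id_Comp H by metis
  moreover have "u \<cdot> w = Id C T"
    using coproduct_unique[OF T Comp_Hom[OF w(1) u(1)] Id_Hom] Hom_Obj[OF H(3)] u w
      Comp_assoc[OF _ w(1) u(1), symmetric] Id_Comp H by metis
  ultimately show thesis using that u w iso_arrowI by blast
qed

end

context weak_model_category
begin

section \<open>Cofibrant and fibrant objects, lifting and extension\<close>

lemma Cofs_isoI:
  assumes "f \<in> Cofs M" "f \<in> Hom M A B" "g \<in> Hom M A' B'" "u \<in> Hom M A A'" "v \<in> Hom M B B'"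
    "iso_arrow M u" "iso_arrow M v" "v \<cdot> f = g \<cdot> u"
  shows "g \<in> Cofs M"
  using assms Cofs_iso unfolding closed_under_arrow_iso_def by (auto simp: Hom_def)

lemma Fibs_isoI:
  assumes "f \<in> Fibs M" "f \<in> Hom M A B" "g \<in> Hom M A' B'" "u \<in> Hom M A A'" "v \<in> Hom M B B'"
    "iso_arrow M u" "iso_arrow M v" "v \<cdot> f = g \<cdot> u"
  shows "g \<in> Fibs M"
  using assms Fibs_iso unfolding closed_under_arrow_iso_def by (auto simp: Hom_def)

text \<open>\<open>cofibrant\<close> only provides a cofibration from some initial object. Any other
  initial object is isomorphic to that one, and cofibrations are closed under isomorphism of
  arrows.\<close>

lemma cofibrant_Cofs:
  assumes "cofibrant M X" "initial_object M Z" "f \<in> Hom M Z X"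
  shows "f \<in> Cofs M"
proof -
  obtain Z' g where g: "initial_object M Z'" "g \<in> Hom M Z' X" "g \<in> Cofs M"
    using assms(1) by (auto simp: cofibrant_def)
  obtain u where u: "u \<in> Hom M Z' Z" using g assms(2) unfolding initial_object_def by blast
  have X: "X \<in> Obj M" using assms(1) by (simp add: cofibrant_def)
  have "Id M X \<cdot> g = f \<cdot> u"
    using g X Comp_Hom[OF u assms(3)] Id_Comp[OF g(2)] unfolding initial_object_def by metis
  then show ?thesis
    using Cofs_isoI[OF g(3,2) assms(3) u Id_Hom[OF X]] initial_iso[OF g(1) assms(2) u]
      iso_arrow_Id[OF X] by blast
qed

lemma fibrant_Fibs:
  assumes "fibrant M X" "terminal_object M Z" "f \<in> Hom M X Z"
  shows "f \<in> Fibs M"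
proof -
  obtain Z' g where g: "terminal_object M Z'" "g \<in> Hom M X Z'" "g \<in> Fibs M"
    using assms(1) by (auto simp: fibrant_def)
  obtain u where u: "u \<in> Hom M Z' Z" using g assms(2) unfolding terminal_object_def by blast
  have X: "X \<in> Obj M" using assms(1) by (simp add: fibrant_def)
  have "u \<cdot> g = f \<cdot> Id M X"
    using assms(2) X Comp_Hom[OF g(2) u] assms(3) Comp_Id[OF assms(3)]
    unfolding terminal_object_def by metis
  then show ?thesis
    using Fibs_isoI[OF g(3,2) assms(3) Id_Hom[OF X] u] terminal_iso[OF g(1) assms(2) u]
      iso_arrow_Id[OF X] by blast
qed

lemma initial_cofibrant:
  obtains Z where "initial_object M Z" "cofibrant M Z"
  using initial_ex Id_Hom unfolding cofibrant_def initial_object_def by blast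

lemma terminal_fibrant:
  obtains T where "terminal_object M T" "fibrant M T"
  using terminal_ex Id_Hom unfolding fibrant_def terminal_object_def by blast

lemma cofibrant_comp:
  assumes "i \<in> Hom M A B" "i \<in> Cofs M" "cofibrant M A"
  shows "cofibrant M B"
proof -
  obtain Z where Z: "initial_object M Z" "cofibrant M Z" using initial_cofibrant .
  obtain f where f: "f \<in> Hom M Z A"
    using Z Hom_Obj[OF assms(1)] unfolding initial_object_def by blast
  have "i \<cdot> f \<in> Cofs M"
    using Cofs_Comp[OF f assms(1)] cofibrant_Cofs[OF assms(3) Z(1) f] assms Z by blast
  then show ?thesis
    using Z Comp_Hom[OF f assms(1)] Hom_Obj[OF assms(1)] unfolding cofibrant_def by blast
qed

lemma fibrant_comp:
  assumes "p \<in> Hom M X Y" "p \<in> Fibs M" "fibrant M Y"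
  shows "fibrant M X"
proof -
  obtain T where T: "terminal_object M T" "fibrant M T" using terminal_fibrant .
  obtain f where f: "f \<in> Hom M Y T"
    using T Hom_Obj[OF assms(1)] unfolding terminal_object_def by blast
  have "f \<cdot> p \<in> Fibs M"
    using Fibs_Comp[OF assms(1) f] fibrant_Fibs[OF assms(3) T(1) f] assms T by blast
  then show ?thesis
    using T Comp_Hom[OF assms(1) f] Hom_Obj[OF assms(1)] unfolding fibrant_def by blast
qed

text \<open>The axiom \<open>lifting\<close> also asks for \<open>B\<close> cofibrant and
  \<open>X\<close> fibrant. Both follow by composing \<open>i\<close> with the map from the initial
  object to \<open>A\<close>, and \<open>p\<close> with the map from \<open>Y\<close> to the
  terminal object.\<close>

lemma lift:
  assumes "i \<in> Hom M A B" "i \<in> Cofs M" "cofibrant M A" "p \<in> Hom M X Y" "p \<in> Fibs M" "fibrant M Y"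
    and "i \<in> Weqs M \<or> p \<in> Weqs M" "u \<in> Hom M A X" "v \<in> Hom M B Y" "p \<cdot> u = v \<cdot> i"
  obtains h where "h \<in> Hom M B X" "h \<cdot> i = u" "p \<cdot> h = v"
proof -
  have "has_lifting M i p"
    using assms lifting cofibrant_comp fibrant_comp by blast
  moreover have "Dom M i = A" "Cod M i = B" "Dom M p = X" "Cod M p = Y"
    using assms by (auto simp: Hom_def)
  ultimately show thesis using that assms unfolding has_lifting_def by blast
qed

text \<open>An extension is a lift against the fibration from \<open>X\<close> to the terminal
  object, where every square commutes.\<close>

lemma extend_to_fibrant:
  assumes "i \<in> Hom M A B" "i \<in> Cofs M" "i \<in> Weqs M" "cofibrant M A" "fibrant M X" "u \<in> Hom M A X"
  obtains h where "h \<in> Hom M B X" "h \<cdot> i = u"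
proof -
  obtain T where T: "terminal_object M T" "fibrant M T" using terminal_fibrant .
  obtain p where p: "p \<in> Hom M X T"
    using T Hom_Obj[OF assms(6)] unfolding terminal_object_def by blast
  obtain v where v: "v \<in> Hom M B T"
    using T Hom_Obj[OF assms(1)] unfolding terminal_object_def by blast
  have "p \<cdot> u = v \<cdot> i"
    using T Hom_Obj[OF assms(1)] Comp_Hom[OF assms(6) p] Comp_Hom[OF assms(1) v]
    unfolding terminal_object_def by metis
  then show thesis
    using lift[OF assms(1,2,4) p fibrant_Fibs[OF assms(5) T(1) p] T(2) _ assms(6) v] assms(3) that
    by blast
qed

text \<open>Dually, the lift is taken against the cofibration from the initial object to
  \<open>A\<close>.\<close>

lemma lift_from_cofibrant:
  assumes "p \<in> Hom M X Y" "p \<in> Fibs M" "p \<in> Weqs M" "fibrant M Y" "cofibrant M A" "v \<in> Hom M A Y"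
  obtains h where "h \<in> Hom M A X" "p \<cdot> h = v"
proof -
  obtain Z where Z: "initial_object M Z" "cofibrant M Z" using initial_cofibrant .
  obtain i where i: "i \<in> Hom M Z A"
    using Z Hom_Obj[OF assms(6)] unfolding initial_object_def by blast
  obtain u where u: "u \<in> Hom M Z X"
    using Z Hom_Obj[OF assms(1)] unfolding initial_object_def by blast
  have "p \<cdot> u = v \<cdot> i"
    using Z Hom_Obj[OF assms(1)] Comp_Hom[OF u assms(1)] Comp_Hom[OF i assms(6)]
    unfolding initial_object_def by metis
  then show thesis
    using lift[OF i cofibrant_Cofs[OF assms(5) Z(1) i] Z(2) assms(1,2,4) _ u assms(6)] assms(3) that
    by blast
qed

section \<open>Products of fibrant objects and coproducts of cofibrant objects\<close>

lemma fibrant_product_ex: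
  assumes "fibrant M X" "fibrant M Y"
  obtains P p1 p2 where "is_product M X Y P p1 p2" "p1 \<in> Fibs M"
proof -
  obtain T where T: "terminal_object M T" "fibrant M T" using terminal_fibrant .
  have Obj: "X \<in> Obj M" "Y \<in> Obj M" using assms by (auto simp: fibrant_def)
  then obtain x y where xy: "x \<in> Hom M X T" "y \<in> Hom M Y T"
    using T unfolding terminal_object_def by blast
  obtain p1 p2 where pb: "is_pullback M y x p1 p2" and p1: "p1 \<in> Fibs M"
    using pullback_Fibs[OF xy(2) fibrant_Fibs[OF assms(2) T(1) xy(2)] xy(1) T(2) assms(1)] by blast
  have cod: "Dom M x = X" "Dom M y = Y" using xy by (auto simp: Hom_def)
  have "p1 \<in> Hom M (Dom M p1) X" "p2 \<in> Hom M (Dom M p1) Y"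
    using pb cod unfolding is_pullback_def by (auto simp: Hom_def)
  moreover have "\<exists>!u. u \<in> Hom M Z (Dom M p1) \<and> p1 \<cdot> u = a \<and> p2 \<cdot> u = b"
    if ab: "a \<in> Hom M Z X" "b \<in> Hom M Z Y" for Z a b
  proof -
    have "x \<cdot> a = y \<cdot> b"
      using T Hom_Obj[OF ab(1)] Comp_Hom[OF ab(1) xy(1)] Comp_Hom[OF ab(2) xy(2)]
      unfolding terminal_object_def by metis
    then show ?thesis using pb ab cod unfolding is_pullback_def by simp
  qed
  ultimately have "is_product M X Y (Dom M p1) p1 p2" unfolding is_product_def by blast
  then show thesis using that p1 by blast
qed

text \<open>Carries the fibration property from the product built as a pullback over the terminal
  object to an arbitrary one. Since the statement covers every product, swapping the factors yields
  the second projection as well.\<close>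

lemma product_Fibs:
  assumes "fibrant M X" "fibrant M Y" and P: "is_product M X Y P p1 p2"
  shows "p1 \<in> Fibs M"
proof -
  obtain Q q1 q2 where Q: "is_product M X Y Q q1 q2" "q1 \<in> Fibs M"
    using fibrant_product_ex[OF assms(1,2)] .
  obtain u where u: "u \<in> Hom M Q P" "iso_arrow M u" "p1 \<cdot> u = q1"
    using product_iso[OF Q(1) P] by metis
  have H: "q1 \<in> Hom M Q X" "p1 \<in> Hom M P X" using P Q by (auto simp: is_product_def)
  have X: "X \<in> Obj M" using assms by (simp add: fibrant_def)
  show ?thesis
    using Fibs_isoI[OF Q(2) H u(1) Id_Hom[OF X] u(2) iso_arrow_Id[OF X]] u(3) Id_Comp[OF H(1)]
    by simp
qed

lemma cofibrant_coproduct_ex: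
  assumes "cofibrant M A" "cofibrant M B"
  obtains S i1 i2 where "is_coproduct M A B S i1 i2" "i1 \<in> Cofs M"
proof -
  obtain Z where Z: "initial_object M Z" "cofibrant M Z" using initial_cofibrant .
  have Obj: "A \<in> Obj M" "B \<in> Obj M" using assms by (auto simp: cofibrant_def)
  then obtain x y where xy: "x \<in> Hom M Z A" "y \<in> Hom M Z B"
    using Z unfolding initial_object_def by blast
  obtain i1 i2 where po: "is_pushout M y x i1 i2" and i1: "i1 \<in> Cofs M"
    using pushout_Cofs[OF xy(2) cofibrant_Cofs[OF assms(2) Z(1) xy(2)] xy(1) Z(2) assms(1)] by blast
  have cod: "Cod M x = A" "Cod M y = B" using xy by (auto simp: Hom_def)
  have "i1 \<in> Hom M A (Cod M i1)" "i2 \<in> Hom M B (Cod M i1)"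
    using po cod unfolding is_pushout_def by (auto simp: Hom_def)
  moreover have "\<exists>!u. u \<in> Hom M (Cod M i1) W \<and> u \<cdot> i1 = a \<and> u \<cdot> i2 = b"
    if ab: "a \<in> Hom M A W" "b \<in> Hom M B W" for W a b
  proof -
    have "a \<cdot> x = b \<cdot> y"
      using Z Hom_Obj[OF ab(1)] Comp_Hom[OF xy(1) ab(1)] Comp_Hom[OF xy(2) ab(2)]
      unfolding initial_object_def by metis
    then show ?thesis using po ab cod unfolding is_pushout_def by simp
  qed
  ultimately have "is_coproduct M A B (Cod M i1) i1 i2" unfolding is_coproduct_def by blast
  then show thesis using that i1 by blast
qed

text \<open>A weak cylinder may be built on any coproduct of \<open>c\<close> with itself, so the
  inclusion must be a cofibration for every choice of coproduct.\<close>

lemma coproduct_Cofs: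
  assumes "cofibrant M A" "cofibrant M B" and S: "is_coproduct M A B S i1 i2"
  shows "i1 \<in> Cofs M"
proof -
  obtain T j1 j2 where T: "is_coproduct M A B T j1 j2" "j1 \<in> Cofs M"
    using cofibrant_coproduct_ex[OF assms(1,2)] .
  obtain u where u: "u \<in> Hom M T S" "iso_arrow M u" "u \<cdot> j1 = i1"
    using coproduct_iso[OF T(1) S] by metis
  have H: "j1 \<in> Hom M A T" "i1 \<in> Hom M A S" using S T by (auto simp: is_coproduct_def)
  have A: "A \<in> Obj M" using assms by (simp add: cofibrant_def)
  show ?thesis
    using Cofs_isoI[OF T(2) H Id_Hom[OF A] u(1) iso_arrow_Id[OF A] u(2)] u(3) Comp_Id[OF H(2)]
    by simp
qed

section \<open>Cofibrant replacement and factorization of graphs\<close>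

text \<open>Factor the map from the initial object to \<open>X\<close> as a cofibration followed by
  a trivial fibration.\<close>

lemma cofibrant_replacement:
  assumes "fibrant M X"
  obtains X' g where "g \<in> Hom M X' X" "g \<in> Fibs M" "g \<in> Weqs M" "cofibrant M X'" "fibrant M X'"
proof -
  obtain Z where Z: "initial_object M Z" "cofibrant M Z" using initial_cofibrant .
  obtain f where f: "f \<in> Hom M Z X"
    using Z assms unfolding initial_object_def fibrant_def by blast
  obtain X' i p where "i \<in> Hom M Z X'" "i \<in> Cofs M" "p \<in> Hom M X' X" "p \<in> Fibs M" "p \<in> Weqs M"
    using factor_Cof_tFib[OF f Z(2) assms] by blast
  then show thesis using that[of p X'] Z assms cofibrant_comp fibrant_comp by blast
qed

lemma Id_Weqs: "fib_or_cof M X \<Longrightarrow> Id M X \<in> Weqs M"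
  using iso_Weqs Id_Hom iso_arrow_Id unfolding fibrant_def cofibrant_def by blast

text \<open>Cofibrancy of \<open>X\<close> allows the graph of \<open>f\<close> to be factored. The
  last conclusion is the lifting property of the fibration from \<open>W\<close> to the product
  against trivial cofibrations, written in components so that the product itself does not
  appear.\<close>

lemma graph_factorization:
  assumes X: "cofibrant M X" "fibrant M X" and Y: "fibrant M Y" and f: "f \<in> Hom M X Y" "f \<in> Weqs M"
  obtains W s p q where "s \<in> Hom M X W" "p \<in> Hom M W X" "q \<in> Hom M W Y"
    "p \<in> Fibs M" "p \<in> Weqs M" "q \<in> Fibs M" "q \<in> Weqs M" "p \<cdot> s = Id M X" "q \<cdot> s = f" "fibrant M W"
    "\<And>i A B u a b. \<lbrakk>i \<in> Hom M A B; i \<in> Cofs M; i \<in> Weqs M; cofibrant M A; u \<in> Hom M A W;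
       a \<in> Hom M B X; b \<in> Hom M B Y; p \<cdot> u = a \<cdot> i; q \<cdot> u = b \<cdot> i\<rbrakk> \<Longrightarrow>
       \<exists>h\<in>Hom M B W. h \<cdot> i = u \<and> p \<cdot> h = a \<and> q \<cdot> h = b"
proof -
  have XO: "X \<in> Obj M" using X by (simp add: fibrant_def)
  obtain P p1 p2 where P: "is_product M X Y P p1 p2" using fibrant_product_ex[OF X(2) Y] .
  have H: "p1 \<in> Hom M P X" "p2 \<in> Hom M P Y" using P by (auto simp: is_product_def)
  have fib: "p1 \<in> Fibs M" "p2 \<in> Fibs M"
    using product_Fibs[OF X(2) Y P] product_Fibs[OF Y X(2) is_product_commute[OF P]] .
  then have PF: "fibrant M P" using fibrant_comp H X by blast
  obtain g where g: "g \<in> Hom M X P" "p1 \<cdot> g = Id M X" "p2 \<cdot> g = f"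
    using product_mediator[OF P Id_Hom[OF XO] f(1)] .
  obtain W s r where s: "s \<in> Hom M X W" "s \<in> Weqs M" and r: "r \<in> Hom M W P" "r \<in> Fibs M"
    and rs: "r \<cdot> s = g"
    using factor_tCof_Fib[OF g(1) X(1) PF] by blast
  have WF: "fibrant M W" using fibrant_comp[OF r PF] .
  have pH: "p1 \<cdot> r \<in> Hom M W X" "p2 \<cdot> r \<in> Hom M W Y" using Comp_Hom r H by auto
  have sections: "(p1 \<cdot> r) \<cdot> s = Id M X" "(p2 \<cdot> r) \<cdot> s = f"
    using Comp_assoc[OF s(1) r(1)] H rs g by auto
  have "p1 \<cdot> r \<in> Fibs M" "p2 \<cdot> r \<in> Fibs M"
    using Fibs_Comp[OF r(1)] r H fib X Y by blast+
  \<comment> \<open>Two-out-of-three: \<open>s\<close> is a weak equivalence, and its composites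
    with the two projections are the identity and \<open>f\<close>.\<close>
  moreover have "p1 \<cdot> r \<in> Weqs M" "p2 \<cdot> r \<in> Weqs M"
    using two_out_of_three[OF s(1) pH(1)] two_out_of_three[OF s(1) pH(2)] s(2) sections f(2)
      Id_Weqs X Y WF by auto
  moreover have "\<exists>h\<in>Hom M B W. h \<cdot> i = u \<and> (p1 \<cdot> r) \<cdot> h = a \<and> (p2 \<cdot> r) \<cdot> h = b"
    if i: "i \<in> Hom M A B" "i \<in> Cofs M" "i \<in> Weqs M" "cofibrant M A" and u: "u \<in> Hom M A W"
      and ab: "a \<in> Hom M B X" "b \<in> Hom M B Y" "(p1 \<cdot> r) \<cdot> u = a \<cdot> i" "(p2 \<cdot> r) \<cdot> u = b \<cdot> i"
    for i A B u a b
  proof -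
    obtain v where v: "v \<in> Hom M B P" "p1 \<cdot> v = a" "p2 \<cdot> v = b"
      using product_mediator[OF P ab(1,2)] .
    have "r \<cdot> u = v \<cdot> i"
      using product_unique[OF P Comp_Hom[OF u r(1)] Comp_Hom[OF i(1) v(1)]] ab v
        Comp_assoc[OF u r(1)] Comp_assoc[OF i(1) v(1)] H by simp
    then obtain h where h: "h \<in> Hom M B W" "h \<cdot> i = u" "r \<cdot> h = v"
      using lift[OF i(1,2,4) r PF _ u v(1)] i(3) by blast
    then show ?thesis
      using Comp_assoc[OF h(1) r(1)] H v by auto
  qed
  ultimately show thesis using that[OF s(1) pH] sections WF by blast
qed

section \<open>The two invariance properties\<close>

context
  fixes lam :: "'k rel" and L :: "('o, 'm, 'l) cof_algebra" and c :: 'o and phi :: 'l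
  assumes L: "initial_boolean_over_cof TYPE('m set) M lam L"
    and c: "cofibrant M c" and phi: "phi \<in> carrier (algebra_at L c)"
begin

lemma valid_homotopic:
  assumes X: "fibrant M X" and "homotopic M c X v1 v2"
  shows "valid M lam L X c phi v1 \<longleftrightarrow> valid M lam L X c phi v2"
proof -
  obtain S in1 in2 Ic Dc j d w h where "weak_cylinder M c S in1 in2 Ic Dc j d w"
    and h: "h \<in> Hom M Ic X" "(h \<cdot> j) \<cdot> in1 = v1" "(h \<cdot> j) \<cdot> in2 = v2"
    using assms(2) unfolding homotopic_def by blast
  then obtain nabla where S: "is_coproduct M c c S in1 in2" and j: "j \<in> Hom M S Ic" "j \<in> Cofs M"
    and d: "d \<in> Hom M c Dc" "d \<in> Cofs M" "d \<in> Weqs M" and w: "w \<in> Hom M Ic Dc" "w \<in> Weqs M"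
    and nabla: "nabla \<in> Hom M S c" "nabla \<cdot> in1 = Id M c" "nabla \<cdot> in2 = Id M c" "w \<cdot> j = d \<cdot> nabla"
    unfolding weak_cylinder_def by blast
  have in12: "in1 \<in> Hom M c S" "in2 \<in> Hom M c S" using S by (auto simp: is_coproduct_def)
  \<comment> \<open>The two ends of the cylinder.\<close>
  define e1 e2 where "e1 = j \<cdot> in1" and "e2 = j \<cdot> in2"
  have e: "e1 \<in> Hom M c Ic" "e2 \<in> Hom M c Ic"
    using Comp_Hom in12 j by (auto simp: e1_def e2_def)
  have we: "w \<cdot> e1 = d" "w \<cdot> e2 = d"
    using Comp_assoc[OF in12(1) j(1) w(1)] Comp_assoc[OF in12(1) nabla(1) d(1)]
      Comp_assoc[OF in12(2) j(1) w(1)] Comp_assoc[OF in12(2) nabla(1) d(1)] nabla Comp_Id[OF d(1)]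
    by (auto simp: e1_def e2_def)
  have "in1 \<in> Cofs M" using coproduct_Cofs[OF c c S] .
  then have "cofibrant M S" using cofibrant_comp in12 c by blast
  then have Ic: "cofibrant M Ic" using cofibrant_comp j by blast
  have Dc: "cofibrant M Dc" using cofibrant_comp d c by blast
  \<comment> \<open>\<open>e1\<close> is a composite of cofibrations, and a weak equivalence by
    two-out-of-three, since \<open>w\<close> and \<open>w \<cdot> e1 = d\<close> are.\<close>
  have e1: "e1 \<in> Cofs M" "e1 \<in> Weqs M"
    using Cofs_Comp[OF in12(1) j(1)] \<open>in1 \<in> Cofs M\<close> j c e1_def
      two_out_of_three[OF e(1) w(1)] we d w Ic Dc by auto
  obtain X' g where g: "g \<in> Hom M X' X" "g \<in> Fibs M" "g \<in> Weqs M"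
    and X': "cofibrant M X'" "fibrant M X'" using cofibrant_replacement[OF X] .
  \<comment> \<open>The cylinder is cofibrant, so the whole homotopy lifts to the replacement
    \<open>X'\<close>, and with it its ends.\<close>
  obtain h' where h': "h' \<in> Hom M Ic X'" "g \<cdot> h' = h"
    using lift_from_cofibrant[OF g X Ic h(1)] .
  define u1 u2 where "u1 = h' \<cdot> e1" and "u2 = h' \<cdot> e2"
  have u: "u1 \<in> Hom M c X'" "u2 \<in> Hom M c X'"
    using Comp_Hom e h' by (auto simp: u1_def u2_def)
  have gu: "g \<cdot> u1 = v1" "g \<cdot> u2 = v2"
    using Comp_assoc[OF e(1) h'(1) g(1)] Comp_assoc[OF e(2) h'(1) g(1)]
      Comp_assoc[OF in12(1) j(1) h(1)] Comp_assoc[OF in12(2) j(1) h(1)] h h'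
    by (auto simp: u1_def u2_def e1_def e2_def)
  have X'O: "X' \<in> Obj M" using X' by (simp add: fibrant_def)
  obtain W s p q where s: "s \<in> Hom M X' W" and p: "p \<in> Hom M W X'" "p \<in> Fibs M" "p \<in> Weqs M"
    and q: "q \<in> Hom M W X'" "q \<in> Fibs M" "q \<in> Weqs M"
    and ps: "p \<cdot> s = Id M X'" "q \<cdot> s = Id M X'" and W: "fibrant M W"
    and W_lift: "\<And>i A B u a b. \<lbrakk>i \<in> Hom M A B; i \<in> Cofs M; i \<in> Weqs M; cofibrant M A; u \<in> Hom M A W;
       a \<in> Hom M B X'; b \<in> Hom M B X'; p \<cdot> u = a \<cdot> i; q \<cdot> u = b \<cdot> i\<rbrakk> \<Longrightarrow>
       \<exists>h\<in>Hom M B W. h \<cdot> i = u \<and> p \<cdot> h = a \<and> q \<cdot> h = b"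
    using graph_factorization[OF X' X'(2) Id_Hom[OF X'O] Id_Weqs] X' by metis
  \<comment> \<open>\<open>k \<cdot> w\<close> is a constant homotopy at \<open>u1\<close>; lifting along the trivial cofibration \<open>e1\<close> starts from
    the degenerate path \<open>s \<cdot> u1\<close> and ends, at \<open>e2\<close>, with a path from \<open>u1\<close> to \<open>u2\<close>.\<close>
  obtain k where k: "k \<in> Hom M Dc X'" "k \<cdot> d = u1"
    using extend_to_fibrant[OF d c X'(2) u(1)] .
  have kw: "k \<cdot> w \<in> Hom M Ic X'" "(k \<cdot> w) \<cdot> e1 = u1" "(k \<cdot> w) \<cdot> e2 = u1"
    using Comp_Hom[OF w(1) k(1)] Comp_assoc[OF e(1) w(1) k(1)] Comp_assoc[OF e(2) w(1) k(1)] we k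
    by auto
  have "p \<cdot> (s \<cdot> u1) = (k \<cdot> w) \<cdot> e1" "q \<cdot> (s \<cdot> u1) = h' \<cdot> e1"
    using Comp_assoc[OF u(1) s] p q ps Id_Comp[OF u(1)] kw u1_def by auto
  then obtain G where G: "G \<in> Hom M Ic W" "p \<cdot> G = k \<cdot> w" "q \<cdot> G = h'"
    using W_lift[OF e(1) e1 c Comp_Hom[OF u(1) s] kw(1) h'(1)] by blast
  have H: "G \<cdot> e2 \<in> Hom M c W" "p \<cdot> (G \<cdot> e2) = u1" "q \<cdot> (G \<cdot> e2) = u2"
    using Comp_Hom[OF e(2) G(1)] Comp_assoc[OF e(2) G(1)] p q G kw u2_def by auto
  \<comment> \<open>Validity travels along \<open>g\<close>, \<open>p\<close>, \<open>q\<close> and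
    \<open>g\<close> again; \<open>p\<close> and \<open>q\<close> are applied to the same map
    \<open>G \<cdot> e2\<close>, which lies over both \<open>u1\<close> and
    \<open>u2\<close>.\<close>
  note valid_tfib = valid_trivial_fibration[OF L _ _ _ _ _ c phi]
  have "valid M lam L X c phi v1 \<longleftrightarrow> valid M lam L X' c phi u1"
    using valid_tfib[OF g X'(2) X u(1)] gu by simp
  also have "\<dots> \<longleftrightarrow> valid M lam L W c phi (G \<cdot> e2)"
    using valid_tfib[OF p W X'(2) H(1)] H by simp
  also have "\<dots> \<longleftrightarrow> valid M lam L X' c phi u2"
    using valid_tfib[OF q W X'(2) H(1)] H by simp
  also have "\<dots> \<longleftrightarrow> valid M lam L X c phi v2"
    using valid_tfib[OF g X'(2) X u(2)] gu by simp
  finally show ?thesis .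
qed

text \<open>Composing \<open>f\<close> with a cofibrant replacement \<open>g\<close> of
  \<open>X\<close> gives a weak equivalence out of an object that is both fibrant and cofibrant, and
  \<open>graph_factorization\<close> applies to it.\<close>

lemma valid_weak_equivalence:
  assumes X: "fibrant M X" and Y: "fibrant M Y" and f: "f \<in> Hom M X Y" "f \<in> Weqs M"
    and v: "v \<in> Hom M c X"
  shows "valid M lam L X c phi v \<longleftrightarrow> valid M lam L Y c phi (f \<cdot> v)"
proof -
  obtain X' g where g: "g \<in> Hom M X' X" "g \<in> Fibs M" "g \<in> Weqs M"
    and X': "cofibrant M X'" "fibrant M X'" using cofibrant_replacement[OF X] .
  obtain u where u: "u \<in> Hom M c X'" "g \<cdot> u = v"
    using lift_from_cofibrant[OF g X c v] .
  have fg: "f \<cdot> g \<in> Hom M X' Y" "f \<cdot> g \<in> Weqs M"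
    using Comp_Hom[OF g(1) f(1)] two_out_of_three[OF g(1) f(1)] g f X Y X' by auto
  obtain W s p q where s: "s \<in> Hom M X' W" and p: "p \<in> Hom M W X'" "p \<in> Fibs M" "p \<in> Weqs M"
    and q: "q \<in> Hom M W Y" "q \<in> Fibs M" "q \<in> Weqs M"
    and ps: "p \<cdot> s = Id M X'" "q \<cdot> s = f \<cdot> g" and W: "fibrant M W"
    using graph_factorization[OF X' Y fg] by metis
  \<comment> \<open>One map into \<open>W\<close> lies over \<open>u\<close> through
    \<open>p\<close> and over \<open>f \<cdot> v\<close> through \<open>q\<close>, because
    \<open>q \<cdot> s = f \<cdot> g\<close> and \<open>g \<cdot> u = v\<close>.\<close>
  have H: "s \<cdot> u \<in> Hom M c W" "p \<cdot> (s \<cdot> u) = u" "q \<cdot> (s \<cdot> u) = f \<cdot> v"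
    using Comp_Hom[OF u(1) s] Comp_assoc[OF u(1) s] p q ps Id_Comp[OF u(1)]
      Comp_assoc[OF u(1) g(1) f(1)] u by auto
  note valid_tfib = valid_trivial_fibration[OF L _ _ _ _ _ c phi]
  have "valid M lam L X c phi v \<longleftrightarrow> valid M lam L X' c phi u"
    using valid_tfib[OF g X'(2) X u(1)] u by simp
  also have "\<dots> \<longleftrightarrow> valid M lam L W c phi (s \<cdot> u)"
    using valid_tfib[OF p W X'(2) H(1)] H by simp
  also have "\<dots> \<longleftrightarrow> valid M lam L Y c phi (f \<cdot> v)"
    using valid_tfib[OF q W Y H(1)] H by simp
  finally show ?thesis .
qed

end

end

theorem theorem2p38:
  fixes M :: "('o, 'm) model_struct"
    and lam :: "'k rel"
    and L :: "('o, 'm, 'l) cof_algebra"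
    and c :: 'o and phi :: 'l
  assumes "weak_model_category M"
    and "Cinfinite lam" and "regularCard lam"
    and "initial_boolean_over_cof TYPE('m set) M lam L"
    and "cofibrant M c"
    and "phi \<in> carrier (algebra_at L c)"
  shows "(\<forall>X v1 v2. fibrant M X \<and> homotopic M c X v1 v2 \<longrightarrow>
            (valid M lam L X c phi v1 \<longleftrightarrow> valid M lam L X c phi v2)) \<and>
         (\<forall>X Y f v. fibrant M X \<and> fibrant M Y \<and> f \<in> Hom M X Y \<and> f \<in> Weqs M \<and> v \<in> Hom M c X \<longrightarrow>
            (valid M lam L X c phi v \<longleftrightarrow> valid M lam L Y c phi (f \<cdot>\<^bsub>M\<^esub> v)))"
proof (intro conjI allI impI; elim conjE)
  fix X v1 v2
  assume "fibrant M X" "homotopic M c X v1 v2"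
  then show "valid M lam L X c phi v1 \<longleftrightarrow> valid M lam L X c phi v2"
    by (rule weak_model_category.valid_homotopic[OF assms(1,4,5,6)])
next
  fix X Y f v
  assume "fibrant M X" "fibrant M Y" "f \<in> Hom M X Y" "f \<in> Weqs M" "v \<in> Hom M c X"
  then show "valid M lam L X c phi v \<longleftrightarrow> valid M lam L Y c phi (f \<cdot>\<^bsub>M\<^esub> v)"
    by (rule weak_model_category.valid_weak_equivalence[OF assms(1,4,5,6)])
qed

end
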